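(* Let $H\in\mathbb{S}^n$, let $A\in\mathbb{R}^{m\times n}$ have full row rank with $m<n$, and let $Z\in\mathbb{R}^{n\times(n-m)}$ have orthonormal columns spanning $\mathcal{N}(A)$. Put $f(\rho):=\lambda_{\min}(H+\rho A^{\mathrm T}A)$ for $\rho\in\mathbb{R}$, $\lambda_*:=\lambda_{\min}(Z^{\mathrm T}HZ)$, $K:=H-\lambda_*I_n$, and $\mathcal{E}_*:=\mathcal{N}(Z^{\mathrm T}HZ-\lambda_*I_{n-m})$. Then the following statements are equivalent: (i) There exists a finite $\rho^*\in\mathbb{R}$ such that $f(\rho^* )=\lambda_*$. (ii) $KZw=0$ for every $w\in\mathcal{E}_*$. (iii) $\mathcal{N}(Z^{\mathrm T}KZ)=\mathcal{N}(Z^{\mathrm T}K^2Z)$. If these conditions hold, there exists $\bar\rho\ge 0$ such that $f(\rho)=\lambda_*$ for every $\rho\ge\bar\rho$. If they fail, then $f(\rho)<\lambda_*$ for every finite $\rho\in\mathbb{R}$, $f$ is strictly increasing on $\mathbb{R}$, and $f(\rho)\uparrow\lambda_*$ as $\rho\to+\infty$.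
   Context: $\mathbb{S}^n$ denotes the space of $n\times n$ real symmetric matrices, $\mathcal{N}(\cdot)$ the null space, and $\lambda_{\min}(M)$ the smallest eigenvalue of a symmetric matrix $M$. The notation $f(\rho)\uparrow\lambda_*$ means convergence to $\lambda_*$ from below, nondecreasingly. *)

theory Defs
  imports "HOL-Analysis.Analysis"
begin

definition symmetric_matrix :: "real^'n^'n \<Rightarrow> bool" where
  "symmetric_matrix M \<longleftrightarrow> transpose M = M"

definition null_space :: "real^'n^'m \<Rightarrow> (real^'n) set" where
  "null_space M = {x. M *v x = 0}"

definition is_eigenvalue :: "real^'n^'n \<Rightarrow> real \<Rightarrow> bool" where
  "is_eigenvalue M l \<longleftrightarrow> (\<exists>v. v \<noteq> 0 \<and> M *v v = l *\<^sub>R v)"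

text \<open>
  Only meaningful when a least real eigenvalue exists, as it does for every symmetric matrix;
  otherwise the value is unspecified.
\<close>
definition lambda_min :: "real^'n^'n \<Rightarrow> real" where
  "lambda_min M = (LEAST l. is_eigenvalue M l)"

definition orthonormal_columns :: "real^'k^'n \<Rightarrow> bool" where
  "orthonormal_columns Z \<longleftrightarrow>
     (\<forall>i j. column i Z \<bullet> column j Z = (if i = j then 1 else 0))"

text \<open>Convergence from below, nondecreasingly, as the argument tends to \<open>+\<infinity>\<close>.\<close>
definition increases_to :: "(real \<Rightarrow> real) \<Rightarrow> real \<Rightarrow> bool" where
  "increases_to f l \<longleftrightarrow> mono f \<and> (\<forall>x. f x \<le> l) \<and> (f \<longlongrightarrow> l) at_top"

end

theory Submission
  imports Defs
begin

text \<open>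
  The quadratic form of \<open>H + \<rho> A\<^sup>T A\<close> at \<open>x\<close> is \<open>\<langle>x, Hx\<rangle> + \<rho> |Ax|\<^sup>2\<close>, so \<open>f\<close> is nondecreasing,
  and testing with \<open>x = Zw\<close> gives \<open>f \<le> \<lambda>\<^sub>*\<close>.  If \<open>f \<rho> = \<lambda>\<^sub>*\<close>, then \<open>K + \<rho> A\<^sup>T A\<close> is positive
  semidefinite with vanishing form at every \<open>Zw\<close>, \<open>w \<in> \<E>\<^sub>*\<close>, which forces \<open>KZw = 0\<close>.  Conversely,
  if \<open>KZ\<close> kills \<open>\<E>\<^sub>*\<close>, then only the orthogonal complement of \<open>Z \<E>\<^sub>*\<close> matters; there the form of
  \<open>K\<close> is positive on \<open>\<N>(A)\<close>, and Finsler's compactness argument gives positive semidefiniteness for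
  all large \<open>\<rho>\<close>.  The same argument applied to \<open>K + \<epsilon> I\<close> gives \<open>f \<rho> \<ge> \<lambda>\<^sub>* - \<epsilon>\<close> eventually.
  Finally, if \<open>f\<close> takes the same value at \<open>\<rho>\<^sub>1 < \<rho>\<^sub>2\<close>, an eigenvector for \<open>\<rho>\<^sub>2\<close> must lie in \<open>\<N>(A)\<close>,
  so this value is at least \<open>\<lambda>\<^sub>*\<close>.
\<close>

section \<open>Adjoints, quadratic forms and the least eigenvalue\<close>

lemma inner_symmetric_matrix:
  fixes M :: "real^'n^'n"
  assumes "symmetric_matrix M"
  shows "x \<bullet> (M *v y) = (M *v x) \<bullet> y"
  by (metis assms dot_lmul_matrix symmetric_matrix_def transpose_matrix_vector)

lemma inner_transpose_matrix:
  fixes A :: "real^'n^'m"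
  shows "x \<bullet> (transpose A *v y) = (A *v x) \<bullet> y"
  by (metis dot_lmul_matrix inner_commute transpose_matrix_vector)

lemma subspace_null_space: "subspace (null_space (M :: real^'n^'m))"
  unfolding null_space_def by (rule linear_subspace_kernel) simp

lemma symmetric_matrix_add:
  "symmetric_matrix M \<Longrightarrow> symmetric_matrix N \<Longrightarrow> symmetric_matrix (M + N)"
  by (simp add: symmetric_matrix_def transpose_def vec_eq_iff)

lemma symmetric_matrix_diff:
  "symmetric_matrix M \<Longrightarrow> symmetric_matrix N \<Longrightarrow> symmetric_matrix (M - N)"
  by (simp add: symmetric_matrix_def transpose_def vec_eq_iff)

lemma symmetric_matrix_scaleR:
  "symmetric_matrix M \<Longrightarrow> symmetric_matrix (c *\<^sub>R M)"
  by (simp add: symmetric_matrix_def transpose_def vec_eq_iff)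

lemma symmetric_matrix_mat: "symmetric_matrix (mat c)"
  by (simp add: symmetric_matrix_def)

lemma symmetric_matrix_congruence:
  fixes M :: "real^'n^'n" and Z :: "real^'k^'n"
  assumes "symmetric_matrix M"
  shows "symmetric_matrix (transpose Z ** M ** Z)"
  using assms by (simp add: symmetric_matrix_def matrix_transpose_mul matrix_mul_assoc)

text \<open>A zero of a nonnegative form minimizes it, so the first-order variation vanishes in
  every direction; along \<open>M *v v\<close> that variation is twice the squared norm of
  \<open>M *v v\<close>.\<close>

lemma psd_form_zero_imp_null:
  fixes M :: "real^'n^'n"
  assumes sym: "symmetric_matrix M"
    and psd: "\<And>x. 0 \<le> x \<bullet> (M *v x)"
    and zero: "v \<bullet> (M *v v) = 0"
  shows "M *v v = 0"
proof (rule ccontr)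
  let ?u = "M *v v"
  assume nz: "?u \<noteq> 0"
  define a where "a = ?u \<bullet> ?u"
  define b where "b = ?u \<bullet> (M *v ?u)"
  have a: "a > 0" using nz by (simp add: a_def)
  have b: "b \<ge> 0" using psd by (simp add: b_def)
  have expand: "0 \<le> 2 * t * a + t\<^sup>2 * b" for t
  proof -
    have "v \<bullet> (M *v ?u) = a"
      using inner_symmetric_matrix[OF sym, of v ?u] by (simp add: a_def)
    then have "(v + t *\<^sub>R ?u) \<bullet> (M *v (v + t *\<^sub>R ?u)) = 2 * t * a + t\<^sup>2 * b"
      using zero
      by (simp add: matrix_vector_right_distrib matrix_vector_mult_scaleR inner_add_left
          inner_add_right a_def b_def power2_eq_square algebra_simps)
    then show ?thesis using psd[of "v + t *\<^sub>R ?u"] by simp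
  qed
  \<comment> \<open>A step against the gradient, short enough for the linear term to win:
    \<open>2 * a + t * b\<close> equals \<open>a + a / (b + 1)\<close>. The \<open>+ 1\<close> keeps
    the denominator positive when \<open>b = 0\<close>.\<close>
  define t where "t = - a / (b + 1)"
  have "t < 0" using a b by (simp add: t_def)
  have "t * b = - a + a / (b + 1)" using b by (simp add: t_def field_simps)
  moreover have "0 \<le> a / (b + 1)" using a b by simp
  ultimately have "2 * a + t * b > 0" using a by linarith
  then have "t * (2 * a + t * b) < 0" using \<open>t < 0\<close> by (simp add: mult_neg_pos)
  then show False using expand[of t] by (simp add: power2_eq_square algebra_simps)
qed

text \<open>By compactness the form attains a minimum \<open>l\<close> on the unit sphere. The form
  of \<open>M - l *\<^sub>R mat 1\<close> is then nonnegative and vanishes at the minimizer, which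
  is therefore an eigenvector. This also shows that the \<open>LEAST\<close> in
  \<open>lambda_min\<close> is attained.\<close>

lemma lambda_min_eigenvector_and_le:
  fixes M :: "real^'n^'n"
  assumes sym: "symmetric_matrix M"
  shows "(\<exists>v. norm v = 1 \<and> M *v v = lambda_min M *\<^sub>R v) \<and>
    (\<forall>x. lambda_min M * (x \<bullet> x) \<le> x \<bullet> (M *v x))"
proof -
  have "sphere (0 :: real^'n) 1 \<noteq> {}" by simp
  moreover have "continuous_on (sphere 0 1) (\<lambda>x. x \<bullet> (M *v x))"
    by (intro continuous_intros linear_continuous_on_compose[OF continuous_on_id]) simp
  ultimately obtain v where v: "norm v = 1"
    and min: "\<And>x. norm x = 1 \<Longrightarrow> v \<bullet> (M *v v) \<le> x \<bullet> (M *v x)"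
    using continuous_attains_inf[OF compact_sphere, of 0 1 "\<lambda>x. x \<bullet> (M *v x)"] by auto
  define l where "l = v \<bullet> (M *v v)"
  have vv: "v \<bullet> v = 1" using v by (simp add: norm_eq_1)
  have le: "l * (x \<bullet> x) \<le> x \<bullet> (M *v x)" for x
  proof (cases "x = 0")
    case False
    have "l \<le> ((1 / norm x) *\<^sub>R x) \<bullet> (M *v ((1 / norm x) *\<^sub>R x))"
      unfolding l_def using False by (intro min) simp
    also have "\<dots> = (x \<bullet> (M *v x)) / (x \<bullet> x)"
      by (simp add: matrix_vector_mult_scaleR dot_square_norm power2_eq_square)
    finally show ?thesis using False by (simp add: field_simps)
  qed simp
  have form: "x \<bullet> ((M - l *\<^sub>R mat 1) *v x) = x \<bullet> (M *v x) - l * (x \<bullet> x)" for x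
    by (simp add: matrix_vector_mult_diff_rdistrib inner_diff_right
        flip: scaleR_matrix_vector_assoc)
  have "(M - l *\<^sub>R mat 1) *v v = 0"
  proof (rule psd_form_zero_imp_null)
    show "symmetric_matrix (M - l *\<^sub>R mat 1)"
      by (intro symmetric_matrix_diff symmetric_matrix_scaleR symmetric_matrix_mat sym)
    show "0 \<le> x \<bullet> ((M - l *\<^sub>R mat 1) *v x)" for x
      using le[of x] by (simp add: form)
    show "v \<bullet> ((M - l *\<^sub>R mat 1) *v v) = 0"
      by (simp add: form vv) (simp add: l_def)
  qed
  then have ev: "M *v v = l *\<^sub>R v"
    by (simp add: matrix_vector_mult_diff_rdistrib flip: scaleR_matrix_vector_assoc)
  have "lambda_min M = l"
    unfolding lambda_min_def
  proof (rule Least_equality)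
    show "is_eigenvalue M l"
      using ev v unfolding is_eigenvalue_def by (intro exI[of _ v]) auto
    show "l \<le> l'" if ev': "is_eigenvalue M l'" for l'
    proof -
      obtain u where "u \<noteq> 0" "M *v u = l' *\<^sub>R u"
        using ev' by (auto simp: is_eigenvalue_def)
      then show ?thesis using le[of u] by simp
    qed
  qed
  then show ?thesis using ev v le by auto
qed

lemma lambda_min_eigenvector:
  fixes M :: "real^'n^'n"
  assumes "symmetric_matrix M"
  obtains v where "v \<bullet> v = 1" "M *v v = lambda_min M *\<^sub>R v"
  using lambda_min_eigenvector_and_le[OF assms] by (auto simp: norm_eq_1)

lemma lambda_min_le_form:
  fixes M :: "real^'n^'n"
  assumes "symmetric_matrix M"
  shows "lambda_min M * (x \<bullet> x) \<le> x \<bullet> (M *v x)"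
  using lambda_min_eigenvector_and_le[OF assms] by blast

lemma lambda_min_geI:
  fixes M :: "real^'n^'n"
  assumes "symmetric_matrix M" and "\<And>x. c * (x \<bullet> x) \<le> x \<bullet> (M *v x)"
  shows "c \<le> lambda_min M"
proof -
  obtain v where "v \<bullet> v = 1" "M *v v = lambda_min M *\<^sub>R v"
    using lambda_min_eigenvector[OF assms(1)] .
  then show ?thesis using assms(2)[of v] by simp
qed

text \<open>Finsler's lemma relative to \<open>W\<close>: if every integer penalty failed, the unit
  vectors witnessing failure would form nested nonempty compact sets, and a common point would
  contradict \<open>pos\<close>.\<close>

lemma finsler_on_subspace:
  fixes B :: "real^'n^'n" and A :: "real^'n^'m"
  assumes W: "subspace W"
    and pos: "\<And>x. x \<in> W \<Longrightarrow> x \<noteq> 0 \<Longrightarrow> A *v x = 0 \<Longrightarrow> 0 < x \<bullet> (B *v x)"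
  obtains r where "0 \<le> r"
    and "\<And>\<rho> x. r \<le> \<rho> \<Longrightarrow> x \<in> W \<Longrightarrow> 0 \<le> x \<bullet> (B *v x) + \<rho> * ((A *v x) \<bullet> (A *v x))"
proof -
  define q where "q \<rho> x = x \<bullet> (B *v x) + \<rho> * ((A *v x) \<bullet> (A *v x))" for \<rho> x
  define F where "F n = (sphere 0 1 \<inter> W) \<inter> {x. q (real n) x \<le> 0}" for n
  have q_mono: "q \<rho> x \<le> q \<rho>' x" if "\<rho> \<le> \<rho>'" for \<rho> \<rho>' x
    using that by (simp add: q_def mult_right_mono)
  have cont: "continuous_on UNIV (q \<rho>)" for \<rho>
    unfolding q_def
    by (intro continuous_intros linear_continuous_on_compose[OF continuous_on_id]) simp_all
  have compact: "compact (F n)" for n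
    unfolding F_def
    by (intro compact_Int_closed compact_sphere closed_subspace[OF W]
        closed_Collect_le cont continuous_intros)
  have "\<exists>n. F n = {}"
  proof (rule ccontr)
    assume "\<nexists>n. F n = {}"
    moreover have "F n \<subseteq> F m" if "m \<le> n" for m n
      unfolding F_def using order_trans[OF q_mono[of "real m" "real n"]] that by auto
    ultimately have "\<Inter>(range F) \<noteq> {}"
      using compact by (intro compact_nest) auto
    then obtain x where x: "\<And>n. x \<in> F n" by auto
    then have "x \<in> W" "norm x = 1" and le: "q (real n) x \<le> 0" for n
      by (auto simp: F_def)
    have "A *v x = 0"
    proof (rule ccontr)
      assume "A *v x \<noteq> 0"
      then have "0 < (A *v x) \<bullet> (A *v x)" by simp
      then obtain n where "- (x \<bullet> (B *v x)) < real n * ((A *v x) \<bullet> (A *v x))"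
        using reals_Archimedean3 by blast
      then show False using le[of n] by (simp add: q_def)
    qed
    \<comment> \<open>Index 0 carries no penalty, so membership in \<open>F 0\<close> says that the
      form of \<open>B\<close> itself is nonpositive at \<open>x\<close>.\<close>
    then show False
      using pos[of x] \<open>x \<in> W\<close> \<open>norm x = 1\<close> le[of 0] by (fastforce simp: q_def)
  qed
  then obtain n where n: "F n = {}" ..
  \<comment> \<open>\<open>q\<close> is homogeneous of degree two, so the estimate on the sphere
    extends to all of \<open>W\<close>.\<close>
  have "0 \<le> q \<rho> x" if "real n \<le> \<rho>" "x \<in> W" for \<rho> x
  proof (cases "x = 0")
    case False
    let ?y = "(1 / norm x) *\<^sub>R x"
    have "?y \<in> sphere 0 1 \<inter> W" using False W that by (simp add: subspace_scale)
    moreover have "?y \<notin> F n" using n by simp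
    ultimately have "0 < q (real n) ?y" by (simp only: F_def Int_iff mem_Collect_eq not_le simp_thms)
    also have "\<dots> \<le> q \<rho> ?y" by (rule q_mono) fact
    also have "\<dots> = q \<rho> x / (norm x)\<^sup>2"
      by (simp add: q_def matrix_vector_mult_scaleR power2_eq_square add_divide_distrib)
    finally show ?thesis using False by (simp add: zero_less_divide_iff)
  qed (simp add: q_def)
  then show thesis by (intro that[of "real n"]) (auto simp: q_def)
qed

theorem theorem3p2:
  fixes H K :: "real^'n^'n"
    and A :: "real^'n^'m"
    and Z :: "real^'k^'n"
    and f :: "real \<Rightarrow> real"
    and lam :: real
    and E :: "(real^'k) set"
  assumes "symmetric_matrix H"
    and "CARD('m) < CARD('n)"
    and "CARD('k) = CARD('n) - CARD('m)"
    and "rank A = CARD('m)"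
    and "orthonormal_columns Z"
    and "span (columns Z) = null_space A"
    and f_def: "f = (\<lambda>\<rho>. lambda_min (H + \<rho> *\<^sub>R (transpose A ** A)))"
    and lam_def: "lam = lambda_min (transpose Z ** H ** Z)"
    and K_def: "K = H - lam *\<^sub>R mat 1"
    and E_def: "E = null_space (transpose Z ** H ** Z - lam *\<^sub>R mat 1)"
  shows "((\<exists>\<rho>. f \<rho> = lam) \<longleftrightarrow> (\<forall>w\<in>E. (K ** Z) *v w = 0)) \<and>
    ((\<forall>w\<in>E. (K ** Z) *v w = 0) \<longleftrightarrow>
       null_space (transpose Z ** K ** Z) = null_space (transpose Z ** (K ** K) ** Z)) \<and>
    ((\<exists>\<rho>. f \<rho> = lam) \<longrightarrow> (\<exists>\<rho>0\<ge>0. \<forall>\<rho>\<ge>\<rho>0. f \<rho> = lam)) \<and>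
    (\<not> (\<exists>\<rho>. f \<rho> = lam) \<longrightarrow>
       (\<forall>\<rho>. f \<rho> < lam) \<and> strict_mono f \<and> increases_to f lam)"
proof -

  \<comment> \<open>Quadratic forms on the null space of \<open>A\<close>, parametrized by
    \<open>Z\<close>\<close>
  let ?Q = "\<lambda>\<rho>. H + \<rho> *\<^sub>R (transpose A ** A)"
  let ?R = "transpose Z ** H ** Z"
  have symK: "symmetric_matrix K"
    unfolding K_def
    by (intro symmetric_matrix_diff symmetric_matrix_scaleR symmetric_matrix_mat assms(1))
  have symQ: "symmetric_matrix (?Q \<rho>)" for \<rho>
    by (intro symmetric_matrix_add symmetric_matrix_scaleR assms(1))
      (simp add: symmetric_matrix_def matrix_transpose_mul)
  have symR: "symmetric_matrix ?R"
    by (rule symmetric_matrix_congruence) (rule assms(1))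
  have formQ: "x \<bullet> (?Q \<rho> *v x) = x \<bullet> (H *v x) + \<rho> * ((A *v x) \<bullet> (A *v x))" for \<rho> x
    by (simp add: matrix_vector_mult_add_rdistrib inner_add_right inner_transpose_matrix
        flip: scaleR_matrix_vector_assoc matrix_vector_mul_assoc del: transpose_matrix_vector)
  have Kv: "K *v x = H *v x - lam *\<^sub>R x" for x
    by (simp add: K_def matrix_vector_mult_diff_rdistrib flip: scaleR_matrix_vector_assoc)
  have formK: "x \<bullet> (K *v x) = x \<bullet> (H *v x) - lam * (x \<bullet> x)" for x
    by (simp add: Kv inner_diff_right)
  have ZZ: "transpose Z ** Z = mat 1"
    using assms(5) by (simp add: matrix_mult_transpose_dot_column orthonormal_columns_def mat_def)
  have innerZ: "(Z *v x) \<bullet> (Z *v y) = x \<bullet> y" for x y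
    by (simp add: ZZ matrix_vector_mul_assoc
        flip: inner_transpose_matrix del: transpose_matrix_vector)
  have formR: "w \<bullet> (?R *v w) = (Z *v w) \<bullet> (H *v (Z *v w))" for w
    by (simp add: inner_transpose_matrix
        flip: matrix_vector_mul_assoc del: transpose_matrix_vector)
  have AZ: "A *v (Z *v w) = 0" for w
    using matrix_vector_mult_in_columnspace[of Z w] assms(6) by (auto simp: null_space_def)
  have kerA: "\<exists>w. x = Z *v w" if "A *v x = 0" for x
  proof -
    have "subspace (range ((*v) Z))"
      by (intro linear_subspace_image subspace_UNIV) simp
    moreover have "columns Z \<subseteq> range ((*v) Z)"
      by (auto simp: columns_image_basis)
    ultimately have "span (columns Z) \<subseteq> range ((*v) Z)" by (simp add: span_minimal)
    then show ?thesis using that assms(6) by (auto simp: null_space_def)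
  qed
  have K_nonneg: "0 \<le> (Z *v w) \<bullet> (K *v (Z *v w))" for w
    using lambda_min_le_form[OF symR, of w] by (simp add: formK innerZ formR flip: lam_def)
  have ZKZ: "(transpose Z ** K ** Z) *v w = ?R *v w - lam *\<^sub>R w" for w
  proof -
    have "(transpose Z ** K ** Z) *v w = transpose Z *v (H *v (Z *v w)) - lam *\<^sub>R ((transpose Z ** Z) *v w)"
      by (simp add: Kv matrix_vector_mult_diff_distrib matrix_vector_mult_scaleR
          flip: matrix_vector_mul_assoc del: transpose_matrix_vector)
    then show ?thesis
      by (simp add: ZZ matrix_vector_mul_assoc matrix_mul_assoc del: transpose_matrix_vector)
  qed
  have E_null: "E = null_space (transpose Z ** K ** Z)"
    by (simp add: E_def null_space_def ZKZ matrix_vector_mult_diff_rdistrib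
        flip: scaleR_matrix_vector_assoc)
  \<comment> \<open>The form of \<open>transpose Z ** K ** Z\<close> is nonnegative, so its zeros
    are exactly its null vectors.\<close>
  have E_iff: "w \<in> E \<longleftrightarrow> (Z *v w) \<bullet> (K *v (Z *v w)) = 0" for w
  proof
    have form: "x \<bullet> ((transpose Z ** K ** Z) *v x) = (Z *v x) \<bullet> (K *v (Z *v x))" for x
      by (simp add: inner_transpose_matrix
          flip: matrix_vector_mul_assoc del: transpose_matrix_vector)
    show "(Z *v w) \<bullet> (K *v (Z *v w)) = 0" if "w \<in> E"
      using that form[of w] by (simp add: E_null null_space_def)
    assume "(Z *v w) \<bullet> (K *v (Z *v w)) = 0"
    then have "(transpose Z ** K ** Z) *v w = 0"
      by (intro psd_form_zero_imp_null symmetric_matrix_congruence symK) (simp_all only: form K_nonneg)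
    then show "w \<in> E" by (simp add: E_null null_space_def)
  qed

  \<comment> \<open>Variational bounds and monotonicity of \<open>f\<close>\<close>
  have f_form: "f \<rho> * (x \<bullet> x) \<le> x \<bullet> (H *v x) + \<rho> * ((A *v x) \<bullet> (A *v x))" for \<rho> x
    using lambda_min_le_form[OF symQ, of \<rho> x] unfolding formQ f_def .
  have f_geI: "c \<le> f \<rho>"
    if "\<And>x. c * (x \<bullet> x) \<le> x \<bullet> (H *v x) + \<rho> * ((A *v x) \<bullet> (A *v x))" for c \<rho>
    unfolding f_def by (rule lambda_min_geI[OF symQ]) (unfold formQ, fact that)
  have f_le: "f \<rho> \<le> lam" for \<rho>
  proof -
    obtain w where "w \<bullet> w = 1" "?R *v w = lam *\<^sub>R w"
      using lambda_min_eigenvector[OF symR] unfolding lam_def .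
    then show ?thesis
      using f_form[of \<rho> "Z *v w"] formR[of w] by (simp add: innerZ AZ)
  qed
  have f_mono: "f \<rho> \<le> f \<rho>'" if "\<rho> \<le> \<rho>'" for \<rho> \<rho>'
  proof (rule f_geI)
    show "f \<rho> * (x \<bullet> x) \<le> x \<bullet> (H *v x) + \<rho>' * ((A *v x) \<bullet> (A *v x))" for x
      using f_form[of \<rho> x] mult_right_mono[OF that, of "(A *v x) \<bullet> (A *v x)"] by simp
  qed

  \<comment> \<open>From attainment (i) to the kernel condition (ii)\<close>
  have i_imp_ii: "(K ** Z) *v w = 0" if "f \<rho> = lam" "w \<in> E" for \<rho> w
  proof -
    \<comment> \<open>Attainment makes \<open>?M\<close> positive semidefinite. At
      \<open>Z *v w\<close> the penalty vanishes, so \<open>?M\<close> acts there as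
      \<open>K\<close>.\<close>
    let ?M = "?Q \<rho> - lam *\<^sub>R mat 1"
    have Mv: "?M *v x = ?Q \<rho> *v x - lam *\<^sub>R x" for x
      by (simp add: matrix_vector_mult_diff_rdistrib flip: scaleR_matrix_vector_assoc)
    have "?M *v (Z *v w) = 0"
    proof (rule psd_form_zero_imp_null)
      show "symmetric_matrix ?M"
        by (intro symmetric_matrix_diff symmetric_matrix_scaleR symmetric_matrix_mat symQ)
      show "0 \<le> x \<bullet> (?M *v x)" for x
        using f_form[of \<rho> x] that(1) by (simp only: Mv inner_diff_right formQ) simp
      show "(Z *v w) \<bullet> (?M *v (Z *v w)) = 0"
        using that(2) unfolding E_iff formK by (simp only: Mv inner_diff_right formQ AZ) simp
    qed
    moreover have "?Q \<rho> *v (Z *v w) = H *v (Z *v w)"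
      by (simp add: matrix_vector_mult_add_rdistrib AZ
          flip: scaleR_matrix_vector_assoc matrix_vector_mul_assoc)
    ultimately show ?thesis
      by (simp add: Mv Kv flip: matrix_vector_mul_assoc)
  qed

  \<comment> \<open>From (ii) to attainment for all large penalties\<close>
  have ii_imp: "\<exists>\<rho>0\<ge>0. \<forall>\<rho>\<ge>\<rho>0. f \<rho> = lam" if ii: "\<forall>w\<in>E. (K ** Z) *v w = 0"
  proof -
    define V where "V = (*v) Z ` E"
    have V: "span V = V"
      unfolding V_def E_def span_eq_iff
      by (intro linear_subspace_image subspace_null_space) simp
    have KV: "K *v v = 0" and AV: "A *v v = 0" if "v \<in> V" for v
      using that ii AZ by (auto simp: V_def matrix_vector_mul_assoc)
    \<comment> \<open>Removing the directions \<open>V\<close>, where the form of \<open>K\<close>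
      degenerates, leaves it strictly positive on the rest of the null space of \<open>A\<close>, as
      Finsler's lemma requires.\<close>
    define W where "W = {x. \<forall>v\<in>V. orthogonal x v}"
    have "subspace W"
      by (auto simp: W_def subspace_def orthogonal_clauses)
    moreover have "0 < x \<bullet> (K *v x)" if "x \<in> W" "x \<noteq> 0" "A *v x = 0" for x
    proof -
      obtain w where w: "x = Z *v w" using kerA \<open>A *v x = 0\<close> by blast
      have "w \<notin> E"
      proof
        assume "w \<in> E"
        then have "orthogonal x x" using that(1) w by (auto simp: W_def V_def)
        then show False using that(2) by (simp add: orthogonal_self)
      qed
      then show ?thesis using K_nonneg[of w] by (simp add: E_iff w)
    qed
    ultimately obtain r where "0 \<le> r"
      and r: "\<And>\<rho> x. r \<le> \<rho> \<Longrightarrow> x \<in> W \<Longrightarrow> 0 \<le> x \<bullet> (K *v x) + \<rho> * ((A *v x) \<bullet> (A *v x))"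
      using finsler_on_subspace[of W A K] by metis
    have "f \<rho> = lam" if "r \<le> \<rho>" for \<rho>
    proof (rule antisym[OF f_le f_geI])
      fix x
      \<comment> \<open>Both \<open>K\<close> and \<open>A\<close> annihilate the
        \<open>V\<close>-component, so the penalized form at \<open>x\<close> depends only on the
        component \<open>y\<close> in \<open>W\<close>.\<close>
      obtain v y where vy: "v \<in> span V" "\<And>w. w \<in> span V \<Longrightarrow> orthogonal y w" "x = v + y"
        using orthogonal_subspace_decomp_exists[of V x] by blast
      then have v: "v \<in> V" and "y \<in> W" by (auto simp: V W_def)
      have "v \<bullet> (K *v y) = 0"
        using inner_symmetric_matrix[OF symK, of v y] KV[OF v] by simp
      then have "x \<bullet> (K *v x) = y \<bullet> (K *v y)"
        using KV[OF v] by (simp add: vy(3) matrix_vector_right_distrib inner_add_left)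
      moreover have "A *v x = A *v y"
        using AV[OF v] by (simp add: vy(3) matrix_vector_right_distrib)
      ultimately have "0 \<le> x \<bullet> (K *v x) + \<rho> * ((A *v x) \<bullet> (A *v x))"
        using r[OF that \<open>y \<in> W\<close>] by simp
      then show "lam * (x \<bullet> x) \<le> x \<bullet> (H *v x) + \<rho> * ((A *v x) \<bullet> (A *v x))"
        by (simp add: formK)
    qed
    then show ?thesis using \<open>0 \<le> r\<close> by blast
  qed

  have i_iff_ii: "(\<exists>\<rho>. f \<rho> = lam) \<longleftrightarrow> (\<forall>w\<in>E. (K ** Z) *v w = 0)"
    using i_imp_ii ii_imp by blast

  \<comment> \<open>Equivalence of (ii) and (iii)\<close>
  have "null_space (transpose Z ** (K ** K) ** Z) = null_space (K ** Z)"
  proof -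
    have "(transpose Z ** (K ** K) ** Z) *v w = 0 \<longleftrightarrow> (K ** Z) *v w = 0" for w
    proof
      assume "(transpose Z ** (K ** K) ** Z) *v w = 0"
      \<comment> \<open>Since \<open>K\<close> is symmetric, the form of
        \<open>transpose Z ** (K ** K) ** Z\<close> at \<open>w\<close> is the squared norm of
        \<open>K *v (Z *v w)\<close>.\<close>
      then have "0 = w \<bullet> ((transpose Z ** (K ** K) ** Z) *v w)" by simp
      also have "\<dots> = (K *v (Z *v w)) \<bullet> (K *v (Z *v w))"
        by (simp add: inner_transpose_matrix inner_symmetric_matrix[OF symK, of "Z *v w"]
            flip: matrix_vector_mul_assoc del: transpose_matrix_vector)
      finally show "(K ** Z) *v w = 0" by (simp flip: matrix_vector_mul_assoc)
    next
      assume "(K ** Z) *v w = 0"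
      then show "(transpose Z ** (K ** K) ** Z) *v w = 0"
        by (simp flip: matrix_vector_mul_assoc)
    qed
    then show ?thesis by (simp add: null_space_def)
  qed
  \<comment> \<open>This inclusion always holds, so (iii) reduces to the reverse one, which is
    (ii).\<close>
  moreover have "null_space (K ** Z) \<subseteq> E"
    by (auto simp: null_space_def E_iff simp flip: matrix_vector_mul_assoc)
  ultimately have ii_iff_iii: "(\<forall>w\<in>E. (K ** Z) *v w = 0) \<longleftrightarrow>
      null_space (transpose Z ** K ** Z) = null_space (transpose Z ** (K ** K) ** Z)"
    by (simp flip: E_null) (auto simp: null_space_def)

  \<comment> \<open>Strict increase below \<open>lam\<close>, and the limit\<close>
  have strict: "f \<rho> < f \<rho>'" if less: "\<rho> < \<rho>'" and below: "f \<rho>' < lam" for \<rho> \<rho>'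
  proof (rule ccontr)
    assume "\<not> f \<rho> < f \<rho>'"
    \<comment> \<open>The eigenvector for the larger penalty also tests the smaller one; without
      strict increase, the comparison forces \<open>A *v v = 0\<close>.\<close>
    obtain v where v: "v \<bullet> v = 1" "?Q \<rho>' *v v = f \<rho>' *\<^sub>R v"
      using lambda_min_eigenvector[OF symQ, of \<rho>'] unfolding f_def .
    then have eq: "f \<rho>' = v \<bullet> (H *v v) + \<rho>' * ((A *v v) \<bullet> (A *v v))"
      using formQ[of v \<rho>'] by simp
    moreover have "f \<rho>' \<le> v \<bullet> (H *v v) + \<rho> * ((A *v v) \<bullet> (A *v v))"
      using f_form[of \<rho> v] v(1) \<open>\<not> f \<rho> < f \<rho>'\<close> by simp
    ultimately have "(\<rho>' - \<rho>) * ((A *v v) \<bullet> (A *v v)) \<le> 0" by (simp add: algebra_simps)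
    then have "(A *v v) \<bullet> (A *v v) \<le> 0" using less by (simp add: mult_le_0_iff)
    then have Av: "A *v v = 0" by (metis inner_gt_zero_iff not_le)
    then obtain w where "v = Z *v w" using kerA by blast
    then show False using K_nonneg[of w] eq Av v(1) below by (simp add: formK)
  qed

  have lim: "(f \<longlongrightarrow> lam) at_top"
  proof (rule tendstoI)
    fix e :: real assume "0 < e"
    \<comment> \<open>The shift makes the form strictly positive on the whole null space of
      \<open>A\<close>, so \<open>W\<close> can be \<open>UNIV\<close>. Using \<open>e/2\<close>
      leaves room for the strict bound \<open>dist (f \<rho>) lam < e\<close>.\<close>
    define B where "B = K + (e/2) *\<^sub>R mat 1"
    have formB: "x \<bullet> (B *v x) = x \<bullet> (K *v x) + e/2 * (x \<bullet> x)" for x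
      by (simp add: B_def matrix_vector_mult_add_rdistrib inner_add_right
          flip: scaleR_matrix_vector_assoc)
    have "0 < x \<bullet> (B *v x)" if "x \<noteq> 0" "A *v x = 0" for x
    proof -
      obtain w where "x = Z *v w" using kerA \<open>A *v x = 0\<close> by blast
      then have "0 \<le> x \<bullet> (K *v x)" using K_nonneg by simp
      moreover have "0 < e/2 * (x \<bullet> x)" using that \<open>0 < e\<close> by simp
      ultimately show ?thesis unfolding formB by linarith
    qed
    then obtain r where r: "\<And>\<rho> x. r \<le> \<rho> \<Longrightarrow> 0 \<le> x \<bullet> (B *v x) + \<rho> * ((A *v x) \<bullet> (A *v x))"
      using finsler_on_subspace[of UNIV A B] by (metis UNIV_I subspace_UNIV)
    have "lam - e/2 \<le> f \<rho>" if "r \<le> \<rho>" for \<rho>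
    proof (rule f_geI)
      show "(lam - e/2) * (x \<bullet> x) \<le> x \<bullet> (H *v x) + \<rho> * ((A *v x) \<bullet> (A *v x))" for x
        using r[OF that, of x] unfolding formB formK by (simp add: algebra_simps)
    qed
    then have "dist (f \<rho>) lam < e" if "r \<le> \<rho>" for \<rho>
      using f_le[of \<rho>] that \<open>0 < e\<close> by (fastforce simp: dist_real_def)
    then show "\<forall>\<^sub>F \<rho> in at_top. dist (f \<rho>) lam < e"
      unfolding eventually_at_top_linorder by blast
  qed

  have "(\<forall>\<rho>. f \<rho> < lam) \<and> strict_mono f \<and> increases_to f lam" if "\<nexists>\<rho>. f \<rho> = lam"
  proof -
    have below: "f \<rho> < lam" for \<rho> using f_le[of \<rho>] that by (metis order_le_less)
    then show ?thesis
      using strict f_mono f_le lim by (auto simp: strict_mono_def increases_to_def mono_def)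
  qed
  then show ?thesis using i_iff_ii ii_iff_iii ii_imp by blast
qed

end
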